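(* There exists a universal constant $C>0$ such that the following holds for every autoregressive model $L$ (equipped with any text prompt), every constraint set $\mathcal S$, and every integer $K\ge 1$. Let $p_b=1-P_L(\mathcal S)$ be the total probability mass of sequences outside $\mathcal S$, let $P_{\mathcal S}=P_L(\cdot)/P_L(\mathcal S)$ on $\mathcal S$, and let $P^K_{\mathrm{IS}}$ be the distribution of the output of the algorithm DISC (described in the context) with maximum number of sampling steps $K$. Then $$\mathrm{KL}\big(P_{\mathcal S}\,\|\,P^K_{\mathrm{IS}}\big)\;\le\; C\cdot\frac{p_b^K}{1-p_b}\left(\sqrt{\frac{p_b(1-p_b)}{K}}+\frac{p_b}{K}\right).$$ In addition, the expected number $k$ of sampling steps of DISC is $$\mathbb E[k]=\frac{1-p_b^K}{1-p_b}+K\,p_b^K\;\le\;\frac{1+e}{1-p_b}.$$ Furthermore, the algorithm is (asymptotically) unbiased: for fixed $L$ and $\mathcal S$, as $K\to\infty$, $$\mathrm{KL}\big(P_{\mathcal S}\,\|\,P^K_{\mathrm{IS}}\big)\to 0,$$ with finite expected number of sampling steps $$\mathbb E[k]\to\frac{1+e}{1-p_b}.$$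
   Context: Let $\mathcal V$ be a finite vocabulary (token set). Sequences are finite sequences of tokens $\boldsymbol x=[x_1,\dots,x_T]$; write $\boldsymbol x_{<t}=[x_1,\dots,x_{t-1}]$, write $\boldsymbol x+\boldsymbol y$ for concatenation, and write $\boldsymbol y\preceq\boldsymbol x$ if $\boldsymbol y$ is a prefix (initial segment, possibly all) of $\boldsymbol x$. An autoregressive model $L$ (with any text prompt and sampling temperature absorbed into it) assigns to each token sequence $\boldsymbol y$ a next-token probability distribution $P_L(\cdot\mid\boldsymbol y)$ on $\mathcal V$, and gives a sequence $\boldsymbol x$ of length $T$ the probability $P_L(\boldsymbol x)=\prod_{t=1}^T P_L(x_t\mid\boldsymbol x_{<t})$. For $B\subseteq\mathcal V$, $P_L(B\mid\boldsymbol y)=\sum_{v\in B}P_L(v\mid\boldsymbol y)$. Complete sequences are terminated by a special end-of-keyword token, regarded as the last token of the sequence and appearing nowhere else; so no sequence of a constraint set is a proper prefix of another. A constraint set $\mathcal S$ is a finite nonempty set of complete sequences, and $P_L(\mathcal S)=\sum_{\boldsymbol s\in\mathcal S}P_L(\boldsymbol s)$. For a sequence $\boldsymbol x$, the set of valid next tokens is $\mathcal A_{\boldsymbol x,\mathcal S}=\{v\in\mathcal V:\exists\,\boldsymbol s\in\mathcal S,\ \boldsymbol x+[v]\preceq\boldsymbol s\}$. It is assumed that $P_L(\mathcal A_{\boldsymbol x,\mathcal S}\mid\boldsymbol x)>0$ for every proper prefix $\boldsymbol x$ (including the empty one) of an element of $\mathcal S$ that can be reached by the procedure SampleCandidate below,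 so that the procedure is well defined, and that $P_L(\mathcal S)>0$, so that $P_{\mathcal S}$ is defined. SampleCandidate: start with the empty sequence $\boldsymbol a=[\,]$ and importance score $x=1$. While $\boldsymbol a\notin\mathcal S$: sample a token $t$ from $P_L(\cdot\mid\boldsymbol a)$ restricted to $\mathcal A_{\boldsymbol a,\mathcal S}$ and renormalized, i.e. with probability $P_L(t\mid\boldsymbol a)/P_L(\mathcal A_{\boldsymbol a,\mathcal S}\mid\boldsymbol a)$ for $t\in\mathcal A_{\boldsymbol a,\mathcal S}$; then update $x\leftarrow x\cdot P_L(\mathcal A_{\boldsymbol a,\mathcal S}\mid\boldsymbol a)$ and $\boldsymbol a\leftarrow\boldsymbol a+[t]$. Return $(\boldsymbol a,x)$. Algorithm DISC with parameter $K$: Phase 1: repeat up to $K$ times: draw a fresh independent $(\boldsymbol a,x)$ from SampleCandidate and an independent $\epsilon$ uniform on $[0,1]$; if $x>\epsilon$ (i.e. with probability $x$), stop and return $\boldsymbol a$. Phase 2 (only if all $K$ samples of Phase 1 were rejected): draw $K$ new independent samples $(\boldsymbol a_1,x_1),\dots,(\boldsymbol a_K,x_K)$ from SampleCandidate and return $\boldsymbol a_j$ with probability $x_j/\sum_{i=1}^K x_i$. The number $k$ of sampling steps is the total number of calls to SampleCandidate made (in Phase 1, plus $K$ further ones if Phase 2 is executed). The expectation is over all the randomness: model sampling, acceptance/rejection, and importance sampling. For discrete distributions $P,Q$ on a set $\mathcal X$, $\mathrm{KL}(P\|Q)=\sum_{x\in\mathcal X}P(x)\ln\frac{P(x)}{Q(x)}$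 (with $0\ln 0=0$).
   Formalization: The final limit is corrected: for fixed L and S, E[k] tends to 1/(1-p_b), not (1+e)/(1-p_b), as the formula for E[k] itself shows (for p_b = 0, E[k] = 1 for all K); the value (1+e)/(1-p_b) is kept as an upper bound. *)

theory Defs
  imports "HOL-Probability.Probability" "HOL-Library.Sublist"
begin

text \<open>
  The vocabulary is a finite set \<open>V\<close> of an arbitrary type and not a type of class \<open>finite\<close>: a
  constant quantified before \<open>V\<close> is then uniform in the vocabulary. Only the values of \<open>L\<close> on
  sequences over \<open>V\<close> matter.
\<close>

definition autoregressive_model :: "'v set \<Rightarrow> ('v list \<Rightarrow> 'v pmf) \<Rightarrow> bool" where
  "autoregressive_model V L \<longleftrightarrow> finite V \<and> (\<forall>y\<in>lists V. set_pmf (L y) \<subseteq> V)"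

definition seq_prob :: "('v list \<Rightarrow> 'v pmf) \<Rightarrow> 'v list \<Rightarrow> real" where
  "seq_prob L x = (\<Prod>t<length x. pmf (L (take t x)) (x ! t))"

definition set_prob :: "('v list \<Rightarrow> 'v pmf) \<Rightarrow> 'v list set \<Rightarrow> real" where
  "set_prob L S = (\<Sum>s\<in>S. seq_prob L s)"

definition complete_seq :: "'v \<Rightarrow> 'v list \<Rightarrow> bool" where
  "complete_seq eok s \<longleftrightarrow> (\<exists>u. s = u @ [eok] \<and> eok \<notin> set u)"

definition constraint_set :: "'v set \<Rightarrow> 'v \<Rightarrow> 'v list set \<Rightarrow> bool" where
  "constraint_set V eok S \<longleftrightarrow>
     finite S \<and> S \<noteq> {} \<and> (\<forall>s\<in>S. s \<in> lists V \<and> complete_seq eok s)"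

definition valid_next :: "'v list set \<Rightarrow> 'v list \<Rightarrow> 'v set" where
  "valid_next S x = {v. \<exists>s\<in>S. prefix (x @ [v]) s}"

text \<open>The sequences that \<open>sample_loop\<close> below visits with positive probability.\<close>

inductive reachable :: "('v list \<Rightarrow> 'v pmf) \<Rightarrow> 'v list set \<Rightarrow> 'v list \<Rightarrow> bool"
  for L :: "'v list \<Rightarrow> 'v pmf" and S :: "'v list set" where
  start: "reachable L S []"
| step: "reachable L S a \<Longrightarrow> a \<notin> S \<Longrightarrow> t \<in> valid_next S a \<Longrightarrow> pmf (L a) t > 0
         \<Longrightarrow> reachable L S (a @ [t])"

definition sampling_well_defined :: "('v list \<Rightarrow> 'v pmf) \<Rightarrow> 'v list set \<Rightarrow> bool" where
  "sampling_well_defined L S \<longleftrightarrow>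
     (\<forall>x. reachable L S x \<and> (\<exists>s\<in>S. strict_prefix x s) \<longrightarrow>
        measure_pmf.prob (L x) (valid_next S x) > 0)"

text \<open>
  The while loop of SampleCandidate. As an \<open>spmf\<close>-valued partial function it gives weight to
  \<open>None\<close> exactly for nontermination. For a constraint set under \<open>sampling_well_defined\<close> every
  reached \<open>a\<close> is a prefix of an element of the finite set \<open>S\<close>, so the loop terminates surely:
  the arguments of \<open>cond_pmf\<close> are proper where it is used, and \<open>the\<close> in \<open>sample_candidate\<close> is
  applied to \<open>Some\<close> only.
\<close>

partial_function (spmf) sample_loop ::
  "('v list \<Rightarrow> 'v pmf) \<Rightarrow> 'v list set \<Rightarrow> 'v list \<Rightarrow> real \<Rightarrow> ('v list \<times> real) spmf" where
  "sample_loop L S a x =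
     (if a \<in> S then return_spmf (a, x)
      else bind_pmf (cond_pmf (L a) (valid_next S a))
        (\<lambda>t. sample_loop L S (a @ [t]) (x * measure_pmf.prob (L a) (valid_next S a))))"

definition sample_candidate ::
  "('v list \<Rightarrow> 'v pmf) \<Rightarrow> 'v list set \<Rightarrow> ('v list \<times> real) pmf" where
  "sample_candidate L S = map_pmf the (sample_loop L S [] 1)"

text \<open>
  Rejection phase with at most \<open>n\<close> trials: the accepted sequence, if any, and the number of
  calls to \<open>sample_candidate\<close>. The test of the score \<open>x\<close> (which lies in \<open>[0,1]\<close>) against a
  uniform variable on \<open>[0,1]\<close> is a Bernoulli trial with parameter \<open>x\<close>.
\<close>

primrec disc_phase1 ::
  "('v list \<Rightarrow> 'v pmf) \<Rightarrow> 'v list set \<Rightarrow> nat \<Rightarrow> ('v list option \<times> nat) pmf" where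
  "disc_phase1 L S 0 = return_pmf (None, 0)"
| "disc_phase1 L S (Suc n) =
     bind_pmf (sample_candidate L S) (\<lambda>(a, x).
     bind_pmf (bernoulli_pmf x) (\<lambda>accept.
       if accept then return_pmf (Some a, 1)
       else map_pmf (\<lambda>(r, k). (r, Suc k)) (disc_phase1 L S n)))"

text \<open>\<open>pmf_of_list\<close> adds up the weights of equal sequences, as choosing the index \<open>j\<close> does.\<close>

definition disc_phase2 ::
  "('v list \<Rightarrow> 'v pmf) \<Rightarrow> 'v list set \<Rightarrow> nat \<Rightarrow> 'v list pmf" where
  "disc_phase2 L S K =
     bind_pmf (replicate_pmf K (sample_candidate L S)) (\<lambda>ys.
       pmf_of_list (map (\<lambda>(a, x). (a, x / sum_list (map snd ys))) ys))"

definition disc ::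
  "('v list \<Rightarrow> 'v pmf) \<Rightarrow> 'v list set \<Rightarrow> nat \<Rightarrow> ('v list \<times> nat) pmf" where
  "disc L S K =
     bind_pmf (disc_phase1 L S K) (\<lambda>(r, k).
       case r of
         Some a \<Rightarrow> return_pmf (a, k)
       | None \<Rightarrow> map_pmf (\<lambda>a. (a, k + K)) (disc_phase2 L S K))"

definition disc_output :: "('v list \<Rightarrow> 'v pmf) \<Rightarrow> 'v list set \<Rightarrow> nat \<Rightarrow> 'v list pmf" where
  "disc_output L S K = map_pmf fst (disc L S K)"

definition disc_steps :: "('v list \<Rightarrow> 'v pmf) \<Rightarrow> 'v list set \<Rightarrow> nat \<Rightarrow> nat pmf" where
  "disc_steps L S K = map_pmf snd (disc L S K)"

text \<open>
  The source states the limit of the expected number of steps, for fixed \<open>L\<close> and \<open>S\<close>, as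
  \<open>(1 + e) / (1 - p)\<close>, where \<open>p\<close> is the mass outside \<open>S\<close>. This contradicts its own formula
  \<open>(1 - p ^ K) / (1 - p) + K * p ^ K\<close>, whose limit is \<open>1 / (1 - p)\<close>; the value
  \<open>(1 + e) / (1 - p)\<close> is an upper bound only. The theorem is stated with the correct limit and
  with that bound.
\<close>

definition expected_steps :: "('v list \<Rightarrow> 'v pmf) \<Rightarrow> 'v list set \<Rightarrow> nat \<Rightarrow> real" where
  "expected_steps L S K = measure_pmf.expectation (disc_steps L S K) real"

definition constrained_dist :: "('v list \<Rightarrow> 'v pmf) \<Rightarrow> 'v list set \<Rightarrow> 'v list \<Rightarrow> real" where
  "constrained_dist L S s = (if s \<in> S then seq_prob L s / set_prob L S else 0)"

text \<open>
  Extended-real valued, so that \<open>P\<close> not being absolutely continuous with respect to \<open>Q\<close> gives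
  \<open>\<infinity>\<close> and not the value induced by division by zero.
\<close>

definition kl_div :: "'a set \<Rightarrow> ('a \<Rightarrow> real) \<Rightarrow> ('a \<Rightarrow> real) \<Rightarrow> ereal" where
  "kl_div X P Q =
     (\<Sum>x\<in>X. if P x = 0 then 0 else if Q x = 0 then \<infinity> else ereal (P x * ln (P x / Q x)))"

end

theory Submission
  imports Defs
begin

text \<open>
  A candidate is \<open>b\<close> with probability \<open>G b\<close> and carries the score \<open>w b\<close>, where
  \<open>G b * w b = P\<^sub>L b\<close>. Hence an acceptance in phase 1 has exactly the law \<open>P\<^sub>S\<close>, and the output
  law is \<open>Q = (1 - q^K) P\<^sub>S + q^K R\<close> with \<open>q = p\<^sub>b\<close> and \<open>R\<close> the law of phase 2. With \<open>p = 1 - q\<close>,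
  \<open>R b = K p P\<^sub>S b E[1 / (w b + T)]\<close> for a sum \<open>T\<close> of \<open>K - 1\<close> independent scores of mean \<open>p\<close>, so
  Jensen gives \<open>P\<^sub>S b / R b \<le> 1 + (w b - p) / (K p)\<close>. Since \<open>ln y \<le> y - 1\<close>, \<open>1/x\<close> is convex and
  \<open>w \<le> 1\<close>, the divergence is at most \<open>q^K / p * (q / K)\<close>, the second summand of the bound for \<open>C = 1\<close>.
\<close>

section \<open>Moments of sums of independent copies with finite support\<close>

lemma expectation_bind_pmf_finite:
  fixes h :: "'b \<Rightarrow> real"
  assumes "finite (set_pmf p)" "\<And>x. x \<in> set_pmf p \<Longrightarrow> finite (set_pmf (f x))"
  shows "measure_pmf.expectation (bind_pmf p f) h =
    measure_pmf.expectation p (\<lambda>x. measure_pmf.expectation (f x) h)"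
  using assms by (simp add: pmf_expectation_bind[of "set_pmf p"] integral_measure_pmf[of "set_pmf p"])

lemma finite_set_replicate_pmf: "finite (set_pmf p) \<Longrightarrow> finite (set_pmf (replicate_pmf n p))"
  by (induction n) auto

lemma replicate_pmf_Suc_map:
  "replicate_pmf (Suc n) p = bind_pmf p (\<lambda>x. map_pmf ((#) x) (replicate_pmf n p))"
  by (simp add: map_pmf_def)

lemma replicate_pmf_map: "replicate_pmf n (map_pmf f p) = map_pmf (map f) (replicate_pmf n p)"
  by (induction n) (simp_all add: map_pmf_def bind_assoc_pmf bind_return_pmf)

lemma expectation_sum_list_replicate_pmf:
  fixes f :: "'a \<Rightarrow> real"
  assumes "finite (set_pmf p)"
  shows "measure_pmf.expectation (replicate_pmf n p) (\<lambda>xs. sum_list (map f xs)) =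
    real n * measure_pmf.expectation p f"
proof (induction n)
  case (Suc n)
  note [simp] = integrable_measure_pmf_finite[OF assms]
    integrable_measure_pmf_finite[OF finite_set_replicate_pmf[OF assms]]
  show ?case
    using assms Suc
    by (simp add: replicate_pmf_Suc_map expectation_bind_pmf_finite finite_set_replicate_pmf
        algebra_simps del: replicate_pmf.simps)
qed simp

text \<open>Expanding the product over pairs of positions, the \<open>n\<close> diagonal pairs
  contribute E[f g], and the \<open>n (n - 1)\<close> others factor by independence. It is applied
  with \<open>f\<close> the indicator of a sequence and \<open>g\<close> its score.\<close>

lemma expectation_sum_list_mult_replicate_pmf:
  fixes f g :: "'a \<Rightarrow> real"
  assumes "finite (set_pmf p)"
  shows "measure_pmf.expectation (replicate_pmf n p)
      (\<lambda>xs. sum_list (map f xs) * sum_list (map g xs)) =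
    real n * measure_pmf.expectation p (\<lambda>x. f x * g x) +
    real n * (real n - 1) * (measure_pmf.expectation p f * measure_pmf.expectation p g)"
proof (induction n)
  case (Suc n)
  note [simp] = integrable_measure_pmf_finite[OF assms]
    integrable_measure_pmf_finite[OF finite_set_replicate_pmf[OF assms]]
    expectation_sum_list_replicate_pmf[OF assms]
  show ?case
    using assms Suc
    by (simp add: replicate_pmf_Suc_map expectation_bind_pmf_finite finite_set_replicate_pmf
        algebra_simps del: replicate_pmf.simps)
qed simp

section \<open>Divergence bounds from \<open>ln y \<le> y - 1\<close>\<close>

lemma kl_div_eq_sum:
  assumes "\<And>x. x \<in> X \<Longrightarrow> P x \<noteq> 0 \<Longrightarrow> 0 < Q x"
  shows "kl_div X P Q = ereal (\<Sum>x\<in>X. P x * ln (P x / Q x))"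
proof -
  have "kl_div X P Q = (\<Sum>x\<in>X. ereal (P x * ln (P x / Q x)))"
    unfolding kl_div_def using assms by (intro sum.cong) force+
  then show ?thesis by simp
qed

text \<open>Gibbs' inequality, termwise: \<open>ln y \<le> y - 1\<close> at
  \<open>y = Q x / P x\<close> bounds each summand below by \<open>P x - Q x\<close>. The mass
  condition is an inequality because \<open>Q\<close> may put mass outside \<open>X\<close>.\<close>

lemma kl_div_nonneg:
  assumes "\<And>x. x \<in> X \<Longrightarrow> 0 \<le> P x" "\<And>x. x \<in> X \<Longrightarrow> 0 \<le> Q x"
    "\<And>x. x \<in> X \<Longrightarrow> P x \<noteq> 0 \<Longrightarrow> 0 < Q x" "(\<Sum>x\<in>X. Q x) \<le> (\<Sum>x\<in>X. P x)"
  shows "0 \<le> kl_div X P Q"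
proof -
  have "P x - Q x \<le> P x * ln (P x / Q x)" if x: "x \<in> X" for x
  proof (cases "P x = 0")
    case False
    then have pos: "0 < P x" "0 < Q x" using assms(1,3) x by (auto simp: order_less_le)
    then have "P x * ln (Q x / P x) \<le> P x * (Q x / P x - 1)"
      by (intro mult_left_mono ln_le_minus_one) auto
    moreover have "P x * (Q x / P x - 1) = Q x - P x" using pos by (simp add: field_simps)
    ultimately show ?thesis using pos by (simp add: ln_div algebra_simps)
  qed (use assms(2) x in auto)
  then have "(\<Sum>x\<in>X. P x - Q x) \<le> (\<Sum>x\<in>X. P x * ln (P x / Q x))" by (rule sum_mono)
  then show ?thesis using assms(3,4) by (simp add: kl_div_eq_sum sum_subtractf)
qed

text \<open>Removes the logarithm: \<open>ln y \<le> y - 1\<close> at \<open>y = P x / Q x\<close>,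
  so only an upper bound on the ratio of the two laws is left to prove.\<close>

lemma kl_div_le:
  assumes "\<And>x. x \<in> X \<Longrightarrow> 0 \<le> P x" "\<And>x. x \<in> X \<Longrightarrow> P x \<noteq> 0 \<Longrightarrow> 0 < Q x"
    "\<And>x. x \<in> X \<Longrightarrow> P x \<noteq> 0 \<Longrightarrow> P x / Q x \<le> 1 + r x"
  shows "kl_div X P Q \<le> ereal (\<Sum>x\<in>X. P x * r x)"
proof -
  have "P x * ln (P x / Q x) \<le> P x * r x" if x: "x \<in> X" for x
  proof (cases "P x = 0")
    case False
    then have "0 < P x / Q x" using assms(1,2) x by (auto simp: order_less_le)
    then have "ln (P x / Q x) \<le> r x"
      using ln_le_minus_one[of "P x / Q x"] assms(3)[OF x False] by linarith
    then show ?thesis using assms(1) x by (intro mult_left_mono) auto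
  qed simp
  then show ?thesis using assms(2) by (simp add: kl_div_eq_sum sum_mono)
qed

section \<open>Scores and probabilities along a sequence, and prefix-freeness\<close>

definition importance_score :: "('v list \<Rightarrow> 'v pmf) \<Rightarrow> 'v list set \<Rightarrow> 'v list \<Rightarrow> real" where
  "importance_score L S b =
    (\<Prod>t<length b. measure_pmf.prob (L (take t b)) (valid_next S (take t b)))"

lemma importance_score_Nil [simp]: "importance_score L S [] = 1"
  by (simp add: importance_score_def)

lemma importance_score_snoc:
  "importance_score L S (a @ [t]) =
    importance_score L S a * measure_pmf.prob (L a) (valid_next S a)"
  by (simp add: importance_score_def)

lemma importance_score_le_1: "importance_score L S b \<le> 1"
  unfolding importance_score_def by (intro prod_le_1) auto

lemma seq_prob_Nil [simp]: "seq_prob L [] = 1"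
  by (simp add: seq_prob_def)

lemma seq_prob_snoc: "seq_prob L (a @ [t]) = seq_prob L a * pmf (L a) t"
  by (simp add: seq_prob_def nth_append)

lemma seq_prob_nonneg: "0 \<le> seq_prob L b"
  by (simp add: seq_prob_def prod_nonneg)

lemma seq_prob_append_eq_0: "seq_prob L a = 0 \<Longrightarrow> seq_prob L (a @ b) = 0"
  by (induction b rule: rev_induct) (simp_all add: seq_prob_snoc flip: append_assoc)

text \<open>In a proper extension of \<open>a\<close>, the final \<open>eok\<close> of
  \<open>a\<close> would occur before the last position.\<close>

lemma complete_seq_prefix_eq:
  assumes "complete_seq eok a" "complete_seq eok b" "prefix a b"
  shows "a = b"
  using assms by (auto simp: complete_seq_def prefix_def append_eq_append_conv2 append_eq_Cons_conv
      Cons_eq_append_conv)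

lemma prefix_snoc_nth: "prefix a b \<Longrightarrow> length a < length b \<Longrightarrow> prefix (a @ [b ! length a]) b"
  by (auto simp: prefix_def nth_append neq_Nil_conv)

section \<open>The joint law of a candidate and its score\<close>

context
  fixes L :: "'v list \<Rightarrow> 'v pmf" and S :: "'v list set" and eok :: 'v
  assumes finS: "finite S" and complete: "\<And>s. s \<in> S \<Longrightarrow> complete_seq eok s"
    and wd: "sampling_well_defined L S"
begin

lemma prob_valid_next_pos:
  assumes "reachable L S a" "s \<in> S" "prefix a s" "a \<notin> S"
  shows "0 < measure_pmf.prob (L a) (valid_next S a)"
  using assms wd unfolding sampling_well_defined_def by (metis strict_prefix_def)

lemma reachable_prefix:
  assumes "reachable L S a" "S \<noteq> {}"
  shows "\<exists>s\<in>S. prefix a s"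
  using assms by (induction rule: reachable.induct) (auto simp: valid_next_def)

lemma reachable_importance_score_pos:
  assumes "reachable L S a" "S \<noteq> {}"
  shows "0 < importance_score L S a"
  using assms
proof (induction rule: reachable.induct)
  case (step a t)
  then obtain s where "s \<in> S" "prefix a s" using reachable_prefix by blast
  then show ?case using step prob_valid_next_pos by (simp add: importance_score_snoc)
qed simp

text \<open>Each pass picks \<open>t\<close> with probability \<open>pmf (L a) t / W\<close> and
  multiplies the score by the same \<open>W\<close>, so the normalizers cancel along the way to
  \<open>b\<close>. The identity for the remaining passes, started at \<open>a\<close>, is
  cross-multiplied to avoid quotients; at \<open>a = []\<close> both outer factors are 1. The loop
  state stays of the form \<open>(a, importance_score L S a)\<close>, so the score is a function of
  the returned sequence.\<close>

lemma sample_loop_distribution: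
  assumes "reachable L S a" "S \<noteq> {}"
  shows "\<exists>G. sample_loop L S a (importance_score L S a) =
      map_pmf (\<lambda>b. Some (b, importance_score L S b)) G \<and>
    (\<forall>b\<in>set_pmf G. b \<in> S \<and> prefix a b \<and> reachable L S b) \<and>
    (\<forall>b\<in>S. prefix a b \<longrightarrow>
      seq_prob L a * (pmf G b * importance_score L S b) = importance_score L S a * seq_prob L b)"
proof -
  obtain M where M: "\<And>s. s \<in> S \<Longrightarrow> length s \<le> M"
    using finS by (metis finite_imageI finite_nat_set_iff_bounded_le imageI)
  show ?thesis
    using assms(1)
  proof (induction "M - length a" arbitrary: a rule: less_induct)
    case less
    let ?sc = "importance_score L S"
    show ?case
    proof (cases "a \<in> S")
      case True
      \<comment> \<open>By prefix-freeness the loop stops at the only element of \<open>S\<close>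
        that extends \<open>a\<close>.\<close>
      have eqa: "b = a" if "b \<in> S" "prefix a b" for b
        using complete_seq_prefix_eq complete True that by metis
      then show ?thesis using True less.prems
        by (intro exI[of _ "return_pmf a"]) (auto simp: sample_loop.simps dest!: eqa)
    next
      case False
      obtain s where s: "s \<in> S" "prefix a s" using reachable_prefix less.prems assms(2) by blast
      define W where "W = measure_pmf.prob (L a) (valid_next S a)"
      have Wpos: "0 < W" unfolding W_def using prob_valid_next_pos less.prems s False by blast
      have ne: "set_pmf (L a) \<inter> valid_next S a \<noteq> {}"
        using Wpos unfolding W_def using measure_pmf_zero_iff[of "L a" "valid_next S a"] by force
      define T where "T = set_pmf (L a) \<inter> valid_next S a"
      define C where "C = cond_pmf (L a) (valid_next S a)"
      have setC: "set_pmf C = T" unfolding C_def T_def by (rule set_cond_pmf[OF ne])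
      have pmfC: "pmf C t = (if t \<in> valid_next S a then pmf (L a) t / W else 0)" for t
        unfolding C_def W_def by (rule pmf_cond[OF ne])
      have reach: "reachable L S (a @ [t])" if "t \<in> T" for t
        using that less.prems False by (auto simp: T_def pmf_positive_iff intro!: reachable.step)
      have "\<forall>t\<in>T. \<exists>G. sample_loop L S (a @ [t]) (?sc (a @ [t])) = map_pmf (\<lambda>b. Some (b, ?sc b)) G \<and>
          (\<forall>b\<in>set_pmf G. b \<in> S \<and> prefix (a @ [t]) b \<and> reachable L S b) \<and>
          (\<forall>b\<in>S. prefix (a @ [t]) b \<longrightarrow>
            seq_prob L (a @ [t]) * (pmf G b * ?sc b) = ?sc (a @ [t]) * seq_prob L b)"
      proof (intro ballI less.hyps)
        fix t assume "t \<in> T"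
        obtain s' where "s' \<in> S" "prefix (a @ [t]) s'"
          using \<open>t \<in> T\<close> by (auto simp: T_def valid_next_def)
        \<comment> \<open>Truncated subtraction decreases strictly only while
          \<open>length a\<close> is below \<open>M\<close>; the element of \<open>S\<close>
          extending \<open>a @ [t]\<close> ensures this.\<close>
        then have "length a < M" using M[of s'] prefix_length_le by fastforce
        then show "M - length (a @ [t]) < M - length a" by simp
      qed (rule reach)
      from bchoice[OF this] obtain G where G:
        "\<And>t. t \<in> T \<Longrightarrow> sample_loop L S (a @ [t]) (?sc (a @ [t])) = map_pmf (\<lambda>b. Some (b, ?sc b)) (G t)"
        "\<And>t b. t \<in> T \<Longrightarrow> b \<in> set_pmf (G t) \<Longrightarrow> b \<in> S \<and> prefix (a @ [t]) b \<and> reachable L S b"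
        "\<And>t b. t \<in> T \<Longrightarrow> b \<in> S \<Longrightarrow> prefix (a @ [t]) b \<Longrightarrow>
            seq_prob L (a @ [t]) * (pmf (G t) b * ?sc b) = ?sc (a @ [t]) * seq_prob L b"
        by blast
      have 1: "sample_loop L S a (?sc a) = map_pmf (\<lambda>b. Some (b, ?sc b)) (bind_pmf C G)"
        using False by (subst sample_loop.simps)
          (auto simp: map_bind_pmf setC G(1)[unfolded importance_score_snoc] simp flip: C_def
            intro!: bind_pmf_cong)
      have 2: "b \<in> S \<and> prefix a b \<and> reachable L S b" if "b \<in> set_pmf (bind_pmf C G)" for b
        using that G(2) by (auto simp: setC dest: append_prefixD)
      have 3: "seq_prob L a * (pmf (bind_pmf C G) b * ?sc b) = ?sc a * seq_prob L b"
        if b: "b \<in> S" "prefix a b" for b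
      proof -
        have "length a < length b"
          using b False by (metis prefix_length_less strict_prefixI)
        define t where "t = b ! length a"
        have pre: "prefix (a @ [t]) b"
          unfolding t_def by (rule prefix_snoc_nth) fact+
        have tv: "t \<in> valid_next S a" using pre b by (auto simp: valid_next_def)
        \<comment> \<open>Only the token that \<open>b\<close> has right after \<open>a\<close> can
          lead to \<open>b\<close>, so the mixture over first tokens collapses to one term.\<close>
        have "pmf (G u) b = 0" if "u \<in> T" "u \<noteq> t" for u
        proof -
          have "\<not> prefix (a @ [u]) b"
            using that(2) pre by (auto simp: prefix_def)
          then show ?thesis using G(2) that(1) by (meson pmf_eq_0_set_pmf)
        qed
        then have "pmf (bind_pmf C G) b = pmf C t * pmf (G t) b"
          unfolding pmf_bind by (subst integral_measure_pmf[of "{t}"]) (auto simp: setC)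
        also have "pmf C t = pmf (L a) t / W" using tv by (simp add: pmfC)
        finally have eq: "pmf (bind_pmf C G) b = pmf (L a) t / W * pmf (G t) b" .
        show ?thesis
        \<comment> \<open>If \<open>t\<close> has probability 0, \<open>G t\<close> is unspecified,
          but both sides vanish: every sequence through \<open>a @ [t]\<close> has probability
          0.\<close>
        proof (cases "pmf (L a) t = 0")
          case True
          then have "seq_prob L (a @ [t]) = 0" by (simp add: seq_prob_snoc)
          then have "seq_prob L b = 0" using pre by (metis prefixE seq_prob_append_eq_0)
          then show ?thesis using True eq by simp
        next
          case False
          then have "t \<in> T" using tv by (simp add: T_def set_pmf_iff)
          from G(3)[OF this b(1) pre] show ?thesis
            unfolding eq using Wpos
            by (simp add: seq_prob_snoc importance_score_snoc field_simps flip: W_def)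
        qed
      qed
      show ?thesis using 1 2 3 by blast
    qed
  qed
qed

lemma sample_candidate_distribution:
  assumes "S \<noteq> {}"
  obtains G where "sample_candidate L S = map_pmf (\<lambda>b. (b, importance_score L S b)) G"
    "set_pmf G \<subseteq> S" "\<And>b. b \<in> set_pmf G \<Longrightarrow> 0 < importance_score L S b"
    "\<And>b. b \<in> S \<Longrightarrow> pmf G b * importance_score L S b = seq_prob L b"
proof -
  from sample_loop_distribution[OF reachable.start assms] obtain G where
    "sample_loop L S [] 1 = map_pmf (\<lambda>b. Some (b, importance_score L S b)) G"
    "\<forall>b\<in>set_pmf G. b \<in> S \<and> reachable L S b"
    "\<forall>b\<in>S. pmf G b * importance_score L S b = seq_prob L b"
    by auto
  then show thesis
    using reachable_importance_score_pos assms
    by (intro that[of G]) (auto simp: sample_candidate_def pmf.map_comp o_def)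
qed

end

text \<open>Isolates what the analysis of DISC uses about SampleCandidate: the score is a function
  of the sequence, lies in (0,1] on the support, and corrects the proposal law \<open>G\<close> to
  the model's probabilities.\<close>

locale weighted_candidates =
  fixes L :: "'v list \<Rightarrow> 'v pmf" and S :: "'v list set"
    and G :: "'v list pmf" and w :: "'v list \<Rightarrow> real"
  assumes candidate: "sample_candidate L S = map_pmf (\<lambda>b. (b, w b)) G"
    and finite_S: "finite S" and set_G: "set_pmf G \<subseteq> S"
    and w_pos: "b \<in> set_pmf G \<Longrightarrow> 0 < w b"
    and w_le_1: "b \<in> set_pmf G \<Longrightarrow> w b \<le> 1"
    and pmf_mult_w: "b \<in> S \<Longrightarrow> pmf G b * w b = seq_prob L b"
begin

section \<open>Phase 1: acceptance, number of trials and accepted sequence\<close>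

lemma finite_G: "finite (set_pmf G)"
  using finite_S set_G by (rule finite_subset[rotated])

text \<open>The probability that one trial of phase 1 accepts; \<open>acc_eq\<close> identifies it
  with the mass of \<open>S\<close>.\<close>

definition acc :: real where "acc = measure_pmf.expectation G w"

lemma finite_phase1: "finite (set_pmf (disc_phase1 L S n))"
  by (induction n) (auto simp: candidate finite_G split: if_splits)

lemma integrable_G [simp]: "integrable (measure_pmf G) (f :: _ \<Rightarrow> real)"
  by (rule integrable_measure_pmf_finite[OF finite_G])

lemma integrable_phase1 [simp]: "integrable (measure_pmf (disc_phase1 L S n)) (f :: _ \<Rightarrow> real)"
  by (rule integrable_measure_pmf_finite[OF finite_phase1])

lemma acc_pos: "0 < acc"
  unfolding acc_def using finite_G w_pos set_pmf_not_empty[of G]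
  by (subst integral_measure_pmf[of "set_pmf G"]) (auto intro!: sum_pos simp: pmf_positive)

lemma acc_le_1: "acc \<le> 1"
  unfolding acc_def
  by (rule measure_pmf.integral_le_const) (auto simp: AE_measure_pmf_iff w_le_1)

text \<open>Conditions on the first trial. After a rejection the remaining trials are independent of
  the rejected \<open>b\<close>, so the weights \<open>1 - w b\<close> average to
  \<open>1 - acc\<close>.\<close>

lemma expectation_phase1_Suc:
  "measure_pmf.expectation (disc_phase1 L S (Suc n)) h =
    measure_pmf.expectation G (\<lambda>b. w b * h (Some b, 1)) +
    (1 - acc) * measure_pmf.expectation (disc_phase1 L S n) (\<lambda>(r, k). h (r, Suc k))"
  for h :: "_ \<Rightarrow> real"
proof -
  let ?E = "measure_pmf.expectation (disc_phase1 L S n) (\<lambda>(r, k). h (r, Suc k))"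
  have "measure_pmf.expectation (disc_phase1 L S (Suc n)) h =
    measure_pmf.expectation G (\<lambda>b. measure_pmf.expectation (bernoulli_pmf (w b) \<bind>
      (\<lambda>accept. if accept then return_pmf (Some b, 1)
       else map_pmf (\<lambda>(r, k). (r, Suc k)) (disc_phase1 L S n))) h)"
    by (simp add: candidate bind_map_pmf)
      (subst expectation_bind_pmf_finite, auto simp: finite_G finite_phase1 split: if_splits)
  also have "\<dots> = measure_pmf.expectation G (\<lambda>b. w b * h (Some b, 1) + (1 - w b) * ?E)"
  proof (rule integral_cong_AE, simp, simp, rule AE_pmfI)
    fix b assume "b \<in> set_pmf G"
    then have "0 \<le> w b" "w b \<le> 1" using w_pos w_le_1 by (auto intro: less_imp_le)
    then show "measure_pmf.expectation (bernoulli_pmf (w b) \<bind>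
      (\<lambda>accept. if accept then return_pmf (Some b, 1)
       else map_pmf (\<lambda>(r, k). (r, Suc k)) (disc_phase1 L S n))) h =
      w b * h (Some b, 1) + (1 - w b) * ?E"
      by (subst expectation_bind_pmf_finite) (auto simp: finite_phase1 case_prod_unfold)
  qed
  also have "\<dots> = measure_pmf.expectation G (\<lambda>b. w b * h (Some b, 1)) + (1 - acc) * ?E"
    by (simp add: acc_def)
  finally show ?thesis .
qed

text \<open>\<open>M\<close> is the cost charged when every trial rejects. It is kept apart from
  \<open>n\<close>, since phase 2 costs \<open>K\<close> throughout while the induction varies the
  number of trials.\<close>

lemma expectation_phase1_steps:
  "measure_pmf.expectation (disc_phase1 L S n)
      (\<lambda>(r, k). real k + (if r = None then M else 0)) =
    (1 - (1 - acc) ^ n) / acc + (1 - acc) ^ n * M"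
proof (induction n)
  case (Suc n)
  have "measure_pmf.expectation (disc_phase1 L S (Suc n))
      (\<lambda>(r, k). real k + (if r = None then M else 0)) =
    acc + (1 - acc) * measure_pmf.expectation (disc_phase1 L S n)
      (\<lambda>x. 1 + (case x of (r, k) \<Rightarrow> real k + (if r = None then M else 0)))"
    by (subst expectation_phase1_Suc) (simp add: acc_def case_prod_unfold algebra_simps)
  also have "\<dots> = acc + (1 - acc) * (1 + ((1 - (1 - acc) ^ n) / acc + (1 - acc) ^ n * M))"
    by (subst Bochner_Integration.integral_add) (simp_all add: Suc)
  finally show ?case using acc_pos by (simp add: field_simps)
qed simp

text \<open>The constant \<open>c\<close> stands for the probability that phase 2 returns
  \<open>a\<close>. The factor of the first summand is the geometric sum over the trial that
  accepts.\<close>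

lemma expectation_phase1_output:
  "measure_pmf.expectation (disc_phase1 L S n)
      (\<lambda>(r, k). case r of Some b \<Rightarrow> indicator {a} b | None \<Rightarrow> c) =
    (1 - (1 - acc) ^ n) / acc * (pmf G a * w a) + (1 - acc) ^ n * c"
proof (induction n)
  case (Suc n)
  have "measure_pmf.expectation G (\<lambda>b. w b * indicator {a} b) = pmf G a * w a"
    by (subst integral_measure_pmf[of "{a}"]) (auto simp: indicator_def split: if_splits)
  then show ?case using acc_pos
    by (subst expectation_phase1_Suc) (simp add: Suc, simp add: field_simps)
qed simp

lemma disc_output_pmf:
  "pmf (disc_output L S K) a =
    (1 - (1 - acc) ^ K) / acc * (pmf G a * w a) + (1 - acc) ^ K * pmf (disc_phase2 L S K) a"
proof -
  have "disc_output L S K = disc_phase1 L S K \<bind>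
    (\<lambda>(r, k). case r of Some b \<Rightarrow> return_pmf b | None \<Rightarrow> disc_phase2 L S K)"
    unfolding disc_output_def disc_def map_bind_pmf
    by (intro bind_pmf_cong) (auto simp: pmf.map_comp o_def split: option.split)
  then have "pmf (disc_output L S K) a = measure_pmf.expectation (disc_phase1 L S K)
    (\<lambda>(r, k). case r of Some b \<Rightarrow> indicator {a} b | None \<Rightarrow> pmf (disc_phase2 L S K) a)"
    by (auto simp: pmf_bind indicator_def intro!: Bochner_Integration.integral_cong split: option.split)
  then show ?thesis by (simp only: expectation_phase1_output)
qed

text \<open>Phase 2 makes \<open>K\<close> calls whatever it returns, so its law drops out.\<close>

lemma disc_steps_eq:
  "disc_steps L S K =
    map_pmf (\<lambda>(r, k). k + (if r = None then K else 0)) (disc_phase1 L S K)"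
  unfolding disc_steps_def disc_def map_bind_pmf map_pmf_def[of _ "disc_phase1 L S K"]
  by (intro bind_pmf_cong)
    (auto simp: pmf.map_comp o_def map_pmf_const split: option.split)

lemma integrable_disc_steps: "integrable (measure_pmf (disc_steps L S K)) real"
  by (rule integrable_measure_pmf_finite) (simp add: disc_steps_eq finite_phase1)

lemma expected_steps_eq:
  "expected_steps L S K = (1 - (1 - acc) ^ K) / acc + real K * (1 - acc) ^ K"
  using expectation_phase1_steps[of K "real K"]
  by (simp add: expected_steps_def disc_steps_eq case_prod_unfold mult.commute if_distrib
      cong: if_cong)

section \<open>Phase 2: self-normalized importance sampling\<close>

lemma disc_phase2_eq:
  "disc_phase2 L S K = replicate_pmf K G \<bind>
    (\<lambda>xs. pmf_of_list (map (\<lambda>b. (b, w b / sum_list (map w xs))) xs))"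
  by (simp add: disc_phase2_def candidate replicate_pmf_map bind_map_pmf o_def)

lemma pmf_importance_choice:
  assumes "xs \<in> set_pmf (replicate_pmf K G)" "1 \<le> K"
  shows "0 < sum_list (map w xs)"
    "pmf (pmf_of_list (map (\<lambda>b. (b, w b / sum_list (map w xs))) xs)) a =
      sum_list (map (indicator {a}) xs) * w a / sum_list (map w xs)"
proof -
  have xs: "set xs \<subseteq> set_pmf G" "xs \<noteq> []"
    using assms by (auto simp: set_replicate_pmf)
  let ?W = "sum_list (map w xs)"
  have w_nonneg: "0 \<le> w b" if "b \<in> set xs" for b
    using that xs w_pos less_imp_le by blast
  show W: "0 < ?W"
    using xs w_pos w_nonneg by (cases xs) (auto intro!: add_pos_nonneg sum_list_nonneg)
  have div: "(\<Sum>b\<leftarrow>ys. w b / c) = sum_list (map w ys) / c" for ys c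
    by (induction ys) (simp_all add: add_divide_distrib)
  have "pmf_of_list_wf (map (\<lambda>b. (b, w b / ?W)) xs)"
    using W w_nonneg by (intro pmf_of_list_wfI) (auto simp: o_def div intro!: divide_nonneg_pos)
  then have "pmf (pmf_of_list (map (\<lambda>b. (b, w b / ?W)) xs)) a =
    sum_list (map snd (filter (\<lambda>z. fst z = a) (map (\<lambda>b. (b, w b / ?W)) xs)))"
    by (rule pmf_pmf_of_list)
  \<comment> \<open>The list and the normalizer are separated, so that the induction on the list
    leaves the normalizer fixed.\<close>
  also have "\<dots> = sum_list (map (indicator {a}) ys) * w a / c"
    if "ys = xs" "c = ?W" for ys c
  proof -
    have "sum_list (map snd (filter (\<lambda>z. fst z = a) (map (\<lambda>b. (b, w b / c)) ys))) =
      sum_list (map (indicator {a}) ys) * w a / c"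
      by (induction ys) (auto simp: add_divide_distrib distrib_right)
    then show ?thesis using that by simp
  qed
  finally show "pmf (pmf_of_list (map (\<lambda>b. (b, w b / ?W)) xs)) a =
    sum_list (map (indicator {a}) xs) * w a / ?W" by simp
qed

text \<open>The probability is E[N w a / W], with N the number of occurrences of \<open>a\<close>
  and W the total score. The denominator is the mean of W once one sample is known to be
  \<open>a\<close>: that sample contributes \<open>w a\<close>, and the other \<open>K - 1\<close>
  have mean score \<open>acc\<close>.\<close>

lemma disc_phase2_pmf_ge:
  assumes "1 \<le> K"  "a \<in> set_pmf G"
  shows "real K * (pmf G a * w a) / (w a + (real K - 1) * acc) \<le> pmf (disc_phase2 L S K) a"
proof -
  define m where "m = w a + (real K - 1) * acc"
  have m: "0 < m" using assms w_pos acc_pos by (simp add: m_def add_pos_nonneg)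
  let ?R = "replicate_pmf K G"
  let ?N = "\<lambda>xs. sum_list (map (indicator {a}) xs) :: real"
  let ?W = "\<lambda>xs. sum_list (map w xs)"
  note [simp] = integrable_measure_pmf_finite[OF finite_set_replicate_pmf[OF finite_G]]
  have E1: "measure_pmf.expectation G (indicator {a}) = pmf G a"
    by (simp add: measure_pmf_single)
  have E2: "measure_pmf.expectation G (\<lambda>b. indicator {a} b * w b) = pmf G a * w a"
    by (subst integral_measure_pmf[of "{a}"]) (auto simp: indicator_def split: if_splits)
  \<comment> \<open>The bound is written as the expectation of N \<open>w a\<close> times the
    tangent \<open>2 / m - W / m^2\<close>, using E[N] = \<open>K * pmf G a\<close> and E[N W] =
    \<open>K * pmf G a * m\<close>.\<close>
  have "real K * (pmf G a * w a) / m =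
    2 * w a / m * (real K * pmf G a) - w a / m\<^sup>2 * (real K * pmf G a * m)"
    using m by (simp add: field_simps power2_eq_square)
  also have "real K * pmf G a * m = measure_pmf.expectation ?R (\<lambda>xs. ?N xs * ?W xs)"
    unfolding expectation_sum_list_mult_replicate_pmf[OF finite_G] E1 E2 acc_def[symmetric] m_def
    by (simp add: algebra_simps)
  also have "real K * pmf G a = measure_pmf.expectation ?R ?N"
    unfolding expectation_sum_list_replicate_pmf[OF finite_G] E1 ..
  also have "2 * w a / m * measure_pmf.expectation ?R ?N -
      w a / m\<^sup>2 * measure_pmf.expectation ?R (\<lambda>xs. ?N xs * ?W xs) =
    measure_pmf.expectation ?R (\<lambda>xs. 2 * w a / m * ?N xs - w a / m\<^sup>2 * (?N xs * ?W xs))"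
    by simp
  also have "\<dots> \<le> measure_pmf.expectation ?R
    (\<lambda>xs. pmf (pmf_of_list (map (\<lambda>b. (b, w b / ?W xs)) xs)) a)"
  proof (rule integral_mono_AE, simp, simp, rule AE_pmfI)
    fix xs assume xs: "xs \<in> set_pmf ?R"
    note choice = pmf_importance_choice[OF xs assms(1)]
    define X where "X = ?W xs"
    have X: "0 < X" using choice(1) by (simp add: X_def)
    have "1 / X - (2 / m - X / m\<^sup>2) = (X - m)\<^sup>2 / (X * m\<^sup>2)"
      using m X by (simp add: field_simps power2_eq_square)
    also have "\<dots> \<ge> 0" using X by simp
    \<comment> \<open>The tangent of \<open>1 / X\<close> at the mean \<open>m\<close> makes Jensen a computation of second moments.\<close>
    finally have "2 / m - X / m\<^sup>2 \<le> 1 / X" by simp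
    moreover have "0 \<le> ?N xs * w a"
      using w_pos[OF assms(2)] by (auto intro!: mult_nonneg_nonneg sum_list_nonneg)
    ultimately have "?N xs * w a * (2 / m - X / m\<^sup>2) \<le> ?N xs * w a * (1 / X)"
      by (rule mult_left_mono)
    then show "2 * w a / m * ?N xs - w a / m\<^sup>2 * (?N xs * ?W xs) \<le>
      pmf (pmf_of_list (map (\<lambda>b. (b, w b / ?W xs)) xs)) a"
      unfolding choice(2) unfolding X_def[symmetric] by (simp add: algebra_simps)
  qed
  finally show ?thesis by (simp add: disc_phase2_eq pmf_bind m_def)
qed


section \<open>Divergence of the output law from the constrained law\<close>

lemma acc_eq: "acc = set_prob L S"
  unfolding acc_def set_prob_def
  by (subst integral_measure_pmf[of S]) (use finite_S set_G pmf_mult_w in auto)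

lemma sum_constrained_dist: "(\<Sum>s\<in>S. constrained_dist L S s) = 1"
  using acc_pos by (simp add: constrained_dist_def acc_eq set_prob_def flip: sum_divide_distrib)

lemma constrained_dist_nonneg: "0 \<le> constrained_dist L S s"
  using acc_pos by (simp add: constrained_dist_def acc_eq seq_prob_nonneg)

text \<open>Absolute continuity: a positive product \<open>pmf G s * w s\<close> forces
  \<open>s\<close> into the support of the proposal.\<close>

lemma constrained_dist_in_G:
  assumes "constrained_dist L S s \<noteq> 0"
  shows "s \<in> set_pmf G" "pmf G s * w s = acc * constrained_dist L S s"
  using assms acc_pos pmf_mult_w[of s]
  by (auto simp: constrained_dist_def acc_eq set_pmf_iff split: if_splits)

text \<open>Convexity of \<open>inverse\<close> splits off the rejection phase, which is exact.\<close>

lemma constrained_dist_ratio: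
  assumes K: "1 \<le> K" and P: "constrained_dist L S s \<noteq> 0"
  shows "0 < pmf (disc_output L S K) s"
    "constrained_dist L S s / pmf (disc_output L S K) s \<le>
      1 + (1 - acc) ^ K * ((w s - acc) / (real K * acc))"
proof -
  define p where "p = constrained_dist L S s"
  define Q where "Q = pmf (disc_output L S K) s"
  define c where "c = (1 - acc) ^ K"
  \<comment> \<open>Chosen so that \<open>p / u\<close> is exactly the lower bound for phase 2, that
    is, \<open>u\<close> bounds the ratio of the constrained law to the law of phase 2.\<close>
  define u where "u = (w s + (real K - 1) * acc) / (real K * acc)"
  note G = constrained_dist_in_G[OF P, folded p_def]
  have p: "0 < p" using P constrained_dist_nonneg[of s] by (simp add: p_def)
  have c: "0 \<le> c" "c \<le> 1"
    using acc_pos acc_le_1 by (auto simp: c_def power_le_one)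
  have "0 < w s + (real K - 1) * acc"
    using w_pos[OF G(1)] K acc_pos by (simp add: add_pos_nonneg)
  then have u: "0 < u" using K acc_pos by (simp add: u_def)
  have "c * (p / u) \<le> c * pmf (disc_phase2 L S K) s"
  proof (rule mult_left_mono)
    have "p / u = real K * (pmf G s * w s) / (w s + (real K - 1) * acc)"
      by (simp add: u_def G(2))
    then show "p / u \<le> pmf (disc_phase2 L S K) s" using disc_phase2_pmf_ge[OF K G(1)] by simp
  qed (rule c(1))
  moreover have "Q = (1 - c) * p + c * pmf (disc_phase2 L S K) s"
    using acc_pos by (simp add: Q_def disc_output_pmf G(2) c_def)
  ultimately have "(1 - c) * p + c * (p / u) \<le> Q" by linarith
  then have Q: "p * (1 - c + c / u) \<le> Q" by (simp add: algebra_simps)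
  \<comment> \<open>A lower bound for \<open>Q / p\<close>: the average of 1 (exact phase 1) and
    \<open>1 / u\<close> (phase 2), weighted by the probability \<open>c\<close> of reaching phase
    2.\<close>
  define d where "d = 1 - c + c / u"
  have d: "0 < d"
  proof (cases "c = 0")
    case False
    then have "0 < c / u" using c u by simp
    then show ?thesis using c by (simp add: d_def add_nonneg_pos)
  qed (simp add: d_def)
  then have Qpos: "0 < Q" using Q mult_pos_pos[OF p d] unfolding d_def by linarith
  then show "0 < pmf (disc_output L S K) s" by (simp add: Q_def)
  \<comment> \<open>Naming the reciprocal makes the convexity gap
    \<open>d * (1 - c + c * u) - 1 = c * (1 - c) * (u + v - 2)\<close> a polynomial identity modulo
    \<open>u * v = 1\<close>.\<close>
  define v where "v = 1 / u"
  have uv: "u * v = 1" using u by (simp add: v_def)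
  have "u + v - 2 = (1 - u)\<^sup>2 / u" using u by (simp add: v_def field_simps power2_eq_square)
  also have "\<dots> \<ge> 0" using u by simp
  finally have "0 \<le> c * (1 - c) * (u + v - 2)" using c by simp
  also have "\<dots> = d * (1 - c + c * u) - 1"
  proof -
    have "d = 1 - c + c * v" by (simp add: d_def v_def)
    then show ?thesis using uv by algebra
  qed
  finally have "1 \<le> d * (1 - c + c * u)" by simp
  then have "p * 1 \<le> p * (d * (1 - c + c * u))" using p by (intro mult_left_mono) auto
  also have "\<dots> = p * d * (1 - c + c * u)" by (simp only: mult.assoc)
  also have "\<dots> \<le> Q * (1 - c + c * u)"
  proof (rule mult_right_mono)
    show "p * d \<le> Q" using Q by (simp only: d_def)
    show "0 \<le> 1 - c + c * u" using c u by simp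
  qed
  finally have "p / Q \<le> 1 - c + c * u" using Qpos by (simp add: pos_divide_le_eq mult.commute)
  moreover have "u = 1 + (w s - acc) / (real K * acc)"
    using K acc_pos by (simp add: u_def field_simps)
  ultimately have "p / Q \<le> 1 + c * ((w s - acc) / (real K * acc))"
    by (simp add: distrib_left)
  then show "constrained_dist L S s / pmf (disc_output L S K) s \<le>
      1 + (1 - acc) ^ K * ((w s - acc) / (real K * acc))"
    by (simp add: p_def Q_def c_def)
qed

lemma kl_div_disc_output_nonneg:
  assumes "1 \<le> K"
  shows "0 \<le> kl_div S (constrained_dist L S) (pmf (disc_output L S K))"
proof (rule kl_div_nonneg)
  show "(\<Sum>x\<in>S. pmf (disc_output L S K) x) \<le> (\<Sum>x\<in>S. constrained_dist L S x)"
    using finite_S by (simp add: sum_constrained_dist flip: measure_measure_pmf_finite)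
qed (use finite_S constrained_dist_nonneg constrained_dist_ratio(1) assms in auto)

lemma kl_div_disc_output_le:
  assumes K: "1 \<le> K"
  shows "kl_div S (constrained_dist L S) (pmf (disc_output L S K)) \<le>
    ereal ((1 - acc) ^ K / acc * ((1 - acc) / real K))"
proof -
  let ?P = "constrained_dist L S"
  define e where "e = (1 - acc) ^ K * (1 / (real K * acc))"
  have e: "0 \<le> e" using acc_pos acc_le_1 by (simp add: e_def)
  have "kl_div S ?P (pmf (disc_output L S K)) \<le> ereal (\<Sum>s\<in>S. ?P s * (e * (1 - acc)))"
  proof (rule kl_div_le)
    fix s assume s: "s \<in> S" "?P s \<noteq> 0"
    show "0 < pmf (disc_output L S K) s" using constrained_dist_ratio(1) K s by blast
    have "?P s / pmf (disc_output L S K) s \<le> 1 + e * (w s - acc)"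
      using constrained_dist_ratio(2)[OF K s(2)] by (simp add: e_def)
    \<comment> \<open>The score bound makes the excess independent of \<open>s\<close>, so averaging
      over the constrained law leaves it unchanged.\<close>
    also have "\<dots> \<le> 1 + e * (1 - acc)"
      using e w_le_1[OF constrained_dist_in_G(1)[OF s(2)]] by (simp add: mult_left_mono)
    finally show "?P s / pmf (disc_output L S K) s \<le> 1 + e * (1 - acc)" .
  qed (use finite_S constrained_dist_nonneg in auto)
  also have "(\<Sum>s\<in>S. ?P s * (e * (1 - acc))) = e * (1 - acc)"
    by (simp add: sum_constrained_dist flip: sum_distrib_right)
  also have "\<dots> = (1 - acc) ^ K / acc * ((1 - acc) / real K)" by (simp add: e_def)
  finally show ?thesis .
qed

end

section \<open>Bound on the step count, and the limits in \<open>K\<close>\<close>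

lemma mult_power_le_geometric:
  fixes q :: real
  assumes "0 \<le> q" "q \<le> 1"
  shows "real n * q ^ n * (1 - q) \<le> 1 - q ^ n"
proof -
  have "real n * q ^ n = (\<Sum>i<n. q ^ n)" by simp
  \<comment> \<open>\<open>q ^ n\<close> is the smallest of the powers up to exponent
    \<open>n\<close>.\<close>
  also have "\<dots> \<le> (\<Sum>i<n. q ^ i)"
    using assms by (intro sum_mono power_decreasing) auto
  finally have "real n * q ^ n * (1 - q) \<le> (\<Sum>i<n. q ^ i) * (1 - q)"
    using assms by (intro mult_right_mono) auto
  also have "\<dots> = 1 - q ^ n" by (simp add: one_diff_power_eq mult.commute)
  finally show ?thesis .
qed

theorem theorem3p1:
  shows "\<exists>C::real. C > 0 \<and>
    (\<forall>(V :: 'v set) (eok :: 'v) (L :: 'v list \<Rightarrow> 'v pmf) (S :: 'v list set).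
      autoregressive_model V L \<longrightarrow> constraint_set V eok S \<longrightarrow>
      sampling_well_defined L S \<longrightarrow> set_prob L S > 0 \<longrightarrow>
      (let p\<^sub>b = 1 - set_prob L S;
           KL = (\<lambda>K. kl_div S (constrained_dist L S) (pmf (disc_output L S K)))
       in
        (\<forall>K::nat. K \<ge> 1 \<longrightarrow>
           KL K \<le> ereal (C * (p\<^sub>b ^ K / (1 - p\<^sub>b)) *
                     (sqrt (p\<^sub>b * (1 - p\<^sub>b) / real K) + p\<^sub>b / real K)) \<and>
           integrable (measure_pmf (disc_steps L S K)) real \<and>
           expected_steps L S K = (1 - p\<^sub>b ^ K) / (1 - p\<^sub>b) + real K * p\<^sub>b ^ K \<and>
           expected_steps L S K \<le> (1 + exp 1) / (1 - p\<^sub>b)) \<and>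
        (KL \<longlonglongrightarrow> 0) \<and>
        (expected_steps L S \<longlonglongrightarrow> 1 / (1 - p\<^sub>b)) \<and>
        1 / (1 - p\<^sub>b) \<le> (1 + exp 1) / (1 - p\<^sub>b)))"
proof (intro exI[of _ 1] conjI allI impI)
  fix V :: "'v set" and eok :: 'v and L :: "'v list \<Rightarrow> 'v pmf" and S :: "'v list set"
  assume S: "constraint_set V eok S" and wd: "sampling_well_defined L S"
  have fin: "finite S" "S \<noteq> {}" and complete: "\<And>s. s \<in> S \<Longrightarrow> complete_seq eok s"
    using S by (auto simp: constraint_set_def)
  obtain G where "sample_candidate L S = map_pmf (\<lambda>b. (b, importance_score L S b)) G"
    "set_pmf G \<subseteq> S" "\<And>b. b \<in> set_pmf G \<Longrightarrow> 0 < importance_score L S b"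
    "\<And>b. b \<in> S \<Longrightarrow> pmf G b * importance_score L S b = seq_prob L b"
    using sample_candidate_distribution[OF fin(1) complete wd fin(2)] by blast
  then interpret weighted_candidates L S G "importance_score L S"
    by unfold_locales (auto simp: fin importance_score_le_1)
  define q where "q = 1 - acc"
  have q: "0 \<le> q" "q < 1" using acc_pos acc_le_1 by (auto simp: q_def)
  let ?KL = "\<lambda>K. kl_div S (constrained_dist L S) (pmf (disc_output L S K))"
  have le: "?KL K \<le> ereal (q ^ K / (1 - q) * (q / real K))" if "1 \<le> K" for K
    using kl_div_disc_output_le[OF that] by (simp add: q_def)
  have steps: "expected_steps L S K = (1 - q ^ K) / (1 - q) + real K * q ^ K" for K
    using expected_steps_eq by (simp add: q_def)
  have bound: "?KL K \<le> ereal (1 * (q ^ K / (1 - q)) * (sqrt (q * (1 - q) / real K) + q / real K))"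
    if "1 \<le> K" for K
  proof -
    \<comment> \<open>The square root enters only as a nonnegative summand.\<close>
    have "q ^ K / (1 - q) * (q / real K) \<le>
      q ^ K / (1 - q) * (sqrt (q * (1 - q) / real K) + q / real K)"
      using q by (intro mult_left_mono) auto
    then have "ereal (q ^ K / (1 - q) * (q / real K)) \<le>
      ereal (q ^ K / (1 - q) * (sqrt (q * (1 - q) / real K) + q / real K))"
      by (simp only: ereal_less_eq(3))
    with le[OF that] show ?thesis by (simp only: mult_1)
  qed
  have steps_le: "expected_steps L S K \<le> (1 + exp 1) / (1 - q)" for K
  proof -
    have "expected_steps L S K * (1 - q) = 1 - q ^ K + real K * q ^ K * (1 - q)"
      using q by (simp add: steps distrib_right)
    \<comment> \<open>In expectation phase 2 adds at most as many calls as phase 1 makes, which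
      gives the constant 2, below \<open>1 + exp 1\<close>.\<close>
    also have "\<dots> \<le> 2 * (1 - q ^ K)"
      using mult_power_le_geometric[of q K] q by simp
    also have "\<dots> \<le> 1 + 1" using q by simp
    also have "\<dots> \<le> 1 + exp 1" by (intro add_left_mono) simp
    finally show ?thesis using q by (simp add: pos_le_divide_eq)
  qed
  have q_power: "(\<lambda>K. q ^ K) \<longlonglongrightarrow> 0"
    using q by (intro LIMSEQ_power_zero) auto
  have KL_lim: "?KL \<longlonglongrightarrow> 0"
  proof (rule tendsto_sandwich[of "\<lambda>_. 0" _ _ "\<lambda>K. ereal (q ^ K / (1 - q) * (q / real K))"])
    \<comment> \<open>Both bounds are taken for \<open>K \<ge> 1\<close>: at \<open>K = 0\<close>
      phase 2 would choose from an empty list.\<close>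
    show "\<forall>\<^sub>F K in sequentially. 0 \<le> ?KL K"
      using eventually_ge_at_top[of 1] by eventually_elim (rule kl_div_disc_output_nonneg)
    show "\<forall>\<^sub>F K in sequentially. ?KL K \<le> ereal (q ^ K / (1 - q) * (q / real K))"
      using eventually_ge_at_top[of 1] by eventually_elim (rule le)
    have "(\<lambda>K. q ^ K / (1 - q) * (q / real K)) \<longlonglongrightarrow> 0 / (1 - q) * 0"
      using q q_power by (intro tendsto_mult[OF tendsto_divide[OF _ tendsto_const] lim_const_over_n]) auto
    then show "(\<lambda>K. ereal (q ^ K / (1 - q) * (q / real K))) \<longlonglongrightarrow> 0"
      by (simp add: zero_ereal_def)
  qed simp
  have "expected_steps L S = (\<lambda>K. (1 - q ^ K) / (1 - q) + real K * q ^ K)"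
    by (simp add: steps fun_eq_iff)
  moreover have "(\<lambda>K. (1 - q ^ K) / (1 - q) + real K * q ^ K) \<longlonglongrightarrow> (1 - 0) / (1 - q) + 0"
    using q q_power
    by (intro tendsto_add[OF tendsto_divide[OF tendsto_diff] powser_times_n_limit_0] tendsto_const)
      auto
  ultimately have steps_lim: "expected_steps L S \<longlonglongrightarrow> 1 / (1 - q)" by simp
  have "1 / (1 - q) \<le> (1 + exp 1) / (1 - q)"
    using q by (intro divide_right_mono) auto
  then show "let p\<^sub>b = 1 - set_prob L S; KL = ?KL in
    (\<forall>K::nat. K \<ge> 1 \<longrightarrow>
       KL K \<le> ereal (1 * (p\<^sub>b ^ K / (1 - p\<^sub>b)) *
                 (sqrt (p\<^sub>b * (1 - p\<^sub>b) / real K) + p\<^sub>b / real K)) \<and>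
       integrable (measure_pmf (disc_steps L S K)) real \<and>
       expected_steps L S K = (1 - p\<^sub>b ^ K) / (1 - p\<^sub>b) + real K * p\<^sub>b ^ K \<and>
       expected_steps L S K \<le> (1 + exp 1) / (1 - p\<^sub>b)) \<and>
    (KL \<longlonglongrightarrow> 0) \<and>
    (expected_steps L S \<longlonglongrightarrow> 1 / (1 - p\<^sub>b)) \<and>
    1 / (1 - p\<^sub>b) \<le> (1 + exp 1) / (1 - p\<^sub>b)"
    unfolding Let_def acc_eq[symmetric] q_def[symmetric]
    by (intro conjI allI impI bound steps steps_le KL_lim steps_lim integrable_disc_steps)
qed simp

end
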